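(* Let $X_i$, $i\in\Lambda$, be spaces with enough arcs. Then their topological sum $X=\bigoplus_{i\in\Lambda}X_i$ has the $\mathcal{AF}$-property.
   Context: For a metrizable space $X$, a continuous map $f\colon X\to X$ and a point $x\in X$, the $\alpha$-limit set of $x$ is $\alpha_f(x)=\bigcap_{n\ge 0}\overline{\bigcup_{k\ge n} f^{-k}(x)}$, where $f^{-k}(x)=\{y\in X: f^k(y)=x\}$. A set $A\subseteq X$ is an $\alpha$-limit set in $X$ if $A=\alpha_f(x)$ for some continuous $f\colon X\to X$ and some $x\in X$. A metrizable space $X$ has the $\mathcal{AF}$-property if the family of $\alpha$-limit sets in $X$ coincides with the family of closed subsets of $X$ (including $\emptyset$ and $X$). An arc is a homeomorphic copy of $[0,1]$. A space with enough arcs is a nondegenerate metrizable space $X$ (i.e. one with at least two points) such that for every nonempty proper closed subset $A\subseteq X$ there is an arc in $X$ with one endpoint in $A$ and the other endpoint in $X\setminus A$. The topological sum is the disjoint union with the disjoint union topology; a topological sum of metrizable spaces is metrizable. *)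

theory Defs
  imports "HOL-Analysis.Analysis"
begin

definition alpha_limit :: "'a topology \<Rightarrow> ('a \<Rightarrow> 'a) \<Rightarrow> 'a \<Rightarrow> 'a set" where
  "alpha_limit X f x =
     (\<Inter>n::nat. X closure_of (\<Union>k\<in>{n..}. {y \<in> topspace X. (f ^^ k) y = x}))"

definition is_alpha_limit_set :: "'a topology \<Rightarrow> 'a set \<Rightarrow> bool" where
  "is_alpha_limit_set X A \<longleftrightarrow>
     (\<exists>f x. continuous_map X X f \<and> x \<in> topspace X \<and> A = alpha_limit X f x)"

definition AF_property :: "'a topology \<Rightarrow> bool" where
  "AF_property X \<longleftrightarrow>
     metrizable_space X \<and> {A. is_alpha_limit_set X A} = {A. closedin X A}"

definition arc_with_endpoints :: "'a topology \<Rightarrow> 'a set \<Rightarrow> 'a \<Rightarrow> 'a \<Rightarrow> bool" where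
  "arc_with_endpoints X C a b \<longleftrightarrow>
     C \<subseteq> topspace X \<and>
     (\<exists>h. homeomorphic_map (top_of_set {0..1::real}) (subtopology X C) h \<and> h 0 = a \<and> h 1 = b)"

definition enough_arcs :: "'a topology \<Rightarrow> bool" where
  "enough_arcs X \<longleftrightarrow>
     metrizable_space X \<and>
     (\<exists>x\<in>topspace X. \<exists>y\<in>topspace X. x \<noteq> y) \<and>
     (\<forall>A. closedin X A \<and> A \<noteq> {} \<and> A \<noteq> topspace X \<longrightarrow>
        (\<exists>C a b. arc_with_endpoints X C a b \<and> a \<in> A \<and> b \<in> topspace X - A))"

end

theory Submission
  imports Defs
begin

text \<open>
  An \<open>\<alpha>\<close>-limit set is an intersection of closures, so it is closed; the point is to realise every
  closed set \<open>A\<close>. If \<open>A\<close> is empty, a constant map and any point other than its value will do.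
  If \<open>A\<close> is nonempty, it suffices to find a continuous map \<open>f\<close> that collapses \<open>A\<close> to a point
  \<open>a \<in> A\<close> and maps the complement of \<open>A\<close> into itself: then every iterated preimage of \<open>a\<close>, except
  the zeroth one, is exactly \<open>A\<close>, and hence \<open>\<alpha>\<^sub>f(a) = A\<close>
  (lemma \<open>is_alpha_limit_set_collapsible\<close>).

  Such an \<open>f\<close> arises in one of two ways. If \<open>A\<close> meets some summand without containing it, that summand
  has an arc leading from \<open>A\<close> to its complement. After the last time at which the arc is in \<open>A\<close>,
  it stays outside \<open>A\<close>; moving a point along this final piece according to its (truncated) distance
  from \<open>A\<close> gives \<open>f\<close> (lemma \<open>is_alpha_limit_set_path_leaving\<close>). If \<open>A\<close> contains every
  summand that it meets, then \<open>A\<close> is open as well as closed, and \<open>f\<close> can be chosen locally constant with at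
  most two values, one in \<open>A\<close> and one outside (lemma \<open>is_alpha_limit_set_clopen\<close>).
\<close>

section \<open>Metrizability of topological sums\<close>

text \<open>
  Distinct summands are placed at distance 1 from one another, and the metrics of the summands are
  truncated at 1 so that the triangle inequality survives a detour through another summand.
\<close>

lemma metrizable_space_sum_topology:
  assumes "\<And>i. i \<in> I \<Longrightarrow> metrizable_space (X i)"
  shows "metrizable_space (sum_topology X I)"
proof -
  have "\<forall>i. \<exists>d. i \<in> I \<longrightarrow> Metric_space (topspace (X i)) d \<and> X i = Metric_space.mtopology (topspace (X i)) d"
    using assms unfolding metrizable_space_def
    by (metis Metric_space.topspace_mtopology)
  then obtain d where d: "\<And>i. i \<in> I \<Longrightarrow> Metric_space (topspace (X i)) (d i)"
    and X: "\<And>i. i \<in> I \<Longrightarrow> X i = Metric_space.mtopology (topspace (X i)) (d i)"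
    by metis
  let ?M = "Sigma I (topspace \<circ> X)"
  \<comment> \<open>Off \<open>I\<close> nothing is known about \<open>d\<close>, while symmetry and nonnegativity are required everywhere.\<close>
  define D where "D p q = (if fst p = fst q \<and> fst p \<in> I
     then min 1 (d (fst p) (snd p) (snd q)) else 1)" for p q
  have D_same: "D (i, x) (i, y) = min 1 (d i x y)" if "i \<in> I" for i x y
    using that by (simp add: D_def)
  have D_other: "D (i, x) (j, y) = 1" if "i \<noteq> j" for i j x y
    using that by (simp add: D_def)
  have d_nonneg: "0 \<le> d i x y" and d_commute: "d i x y = d i y x" if "i \<in> I" for i x y
    using Metric_space.nonneg[OF d[OF that]] Metric_space.commute[OF d[OF that]] by auto
  interpret S: Metric_space ?M D
  proof
    fix p q
    show "0 \<le> D p q"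
      using d_nonneg by (auto simp: D_def)
    show "D p q = D q p"
      using d_commute[of "fst p" "snd p" "snd q"] by (auto simp: D_def)
  next
    fix p q
    assume pq: "p \<in> ?M" "q \<in> ?M"
    have "d (fst p) (snd p) (snd q) = 0 \<longleftrightarrow> snd p = snd q" if "fst p = fst q"
      using pq that by (intro Metric_space.zero[OF d]) auto
    then show "D p q = 0 \<longleftrightarrow> p = q"
      using pq by (auto simp: D_def prod_eq_iff min_def)
  next
    fix p q r
    assume *: "p \<in> ?M" "q \<in> ?M" "r \<in> ?M"
    have "d (fst p) (snd p) (snd r) \<le> d (fst p) (snd p) (snd q) + d (fst p) (snd q) (snd r)"
      if "fst p = fst q" "fst q = fst r"
      using * that by (intro Metric_space.triangle[OF d]) auto
    moreover have "0 \<le> d (fst p) (snd p) (snd q)" "0 \<le> d (fst p) (snd q) (snd r)"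
      using * d_nonneg by auto
    moreover have "fst p \<in> I" "fst q \<in> I" "fst r \<in> I"
      using * by auto
    moreover have "0 \<le> D p q" "0 \<le> D q r" "D p r \<le> 1"
      by (auto simp: D_def d_nonneg)
    ultimately show "D p r \<le> D p q + D q r"
      by (cases "fst p = fst q"; cases "fst q = fst r") (auto simp: D_def min_def)
  qed
  have "openin (sum_topology X I) U \<longleftrightarrow> openin S.mtopology U" for U
  proof
    assume U: "openin (sum_topology X I) U"
    have "\<exists>r>0. S.mball p r \<subseteq> U" if pU: "p \<in> U" for p
    proof -
      obtain i x where p: "p = (i, x)" by force
      then have i: "i \<in> I"
        using U that openin_subset by fastforce
      have "openin (X i) {x. (i, x) \<in> U}"
        using U i by (auto simp: openin_sum_topology)
      then have "openin (Metric_space.mtopology (topspace (X i)) (d i)) {x. (i, x) \<in> U}"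
        using X[OF i] by simp
      then obtain r where r: "r > 0" "Metric_space.mball (topspace (X i)) (d i) x r \<subseteq> {x. (i, x) \<in> U}"
        unfolding Metric_space.openin_mtopology[OF d[OF i]] using pU p by auto
      have "S.mball p (min 1 r) \<subseteq> U"
      proof
        fix q assume q: "q \<in> S.mball p (min 1 r)"
        obtain j y where [simp]: "q = (j, y)" by force
        have "j = i"
          using q D_other[of i j x y] by (auto simp: p)
        then have "d i x y < r"
          using q D_same[OF i, of x y] by (auto simp: p)
        then show "q \<in> U"
          using r q \<open>j = i\<close> by (auto simp: Metric_space.in_mball[OF d[OF i]] p subset_iff)
      qed
      then show ?thesis
        using r by (intro exI[of _ "min 1 r"]) auto
    qed
    then show "openin S.mtopology U"
      unfolding S.openin_mtopology using openin_subset[OF U] by simp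
  next
    assume U: "openin S.mtopology U"
    have "openin (X i) {x. (i, x) \<in> U}" if i: "i \<in> I" for i
    proof -
      have "\<exists>r>0. Metric_space.mball (topspace (X i)) (d i) x r \<subseteq> {x. (i, x) \<in> U}" if "(i, x) \<in> U" for x
      proof -
        obtain r where "r > 0" "S.mball (i, x) r \<subseteq> U"
          using U \<open>(i, x) \<in> U\<close> unfolding S.openin_mtopology by blast
        then show ?thesis
          using i by (intro exI[of _ r])
            (auto simp: Metric_space.in_mball[OF d[OF i]] subset_iff D_same[OF i] min_less_iff_disj)
      qed
      moreover have "{x. (i, x) \<in> U} \<subseteq> topspace (X i)"
        using openin_subset[OF U] by auto
      ultimately have "openin (Metric_space.mtopology (topspace (X i)) (d i)) {x. (i, x) \<in> U}"
        unfolding Metric_space.openin_mtopology[OF d[OF i]] by blast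
      then show ?thesis
        using X[OF i] by simp
    qed
    then show "openin (sum_topology X I) U"
      using openin_subset[OF U] by (simp add: openin_sum_topology)
  qed
  then have "sum_topology X I = S.mtopology"
    by (simp add: topology_eq)
  then show ?thesis
    using S.metrizable_space_mtopology by simp
qed

section \<open>Functions vanishing exactly on a closed set\<close>

text \<open>
  The distance from \<open>A\<close>, truncated at 1, is 1-Lipschitz, and it vanishes only on \<open>A\<close> because
  \<open>A\<close> is closed.
\<close>

lemma metrizable_space_exact_zero_function:
  assumes "metrizable_space X" and A: "closedin X A"
  obtains \<phi> where "continuous_map X (top_of_set {0..1::real}) \<phi>"
    and "\<And>x. x \<in> topspace X \<Longrightarrow> \<phi> x = 0 \<longleftrightarrow> x \<in> A"
proof (cases "A = {}")
  case True
  \<comment> \<open>The infimum of distances to the empty set is an unspecified number, so a nonzero constant serves.\<close>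
  show ?thesis
    by (rule that[of "\<lambda>_. 1"]) (auto simp: True)
next
  case False
  obtain M d where "Metric_space M d" and X: "X = Metric_space.mtopology M d"
    using assms(1) unfolding metrizable_space_def by blast
  interpret Metric_space M d by fact
  have AM: "A \<subseteq> M"
    using closedin_subset[OF A] by (simp add: X)
  define \<rho> where "\<rho> x = (INF a\<in>A. d x a)" for x
  have \<rho>_le: "\<rho> x \<le> d x a" if "a \<in> A" for x a
    unfolding \<rho>_def using that by (intro cINF_lower bdd_belowI[of _ 0]) auto
  have \<rho>_nonneg: "0 \<le> \<rho> x" for x
    unfolding \<rho>_def using False by (intro cINF_greatest) auto
  have Lip: "\<rho> x \<le> d x y + \<rho> y" if "x \<in> M" "y \<in> M" for x y
  proof -
    have "\<rho> x - d x y \<le> d y a" if "a \<in> A" for a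
      using \<rho>_le[OF that, of x] triangle[of x y a] \<open>x \<in> M\<close> \<open>y \<in> M\<close> AM that by fastforce
    then have "\<rho> x - d x y \<le> \<rho> y"
      unfolding \<rho>_def[of y] using False by (intro cINF_greatest) auto
    then show ?thesis by simp
  qed
  have zero_iff: "\<rho> x = 0 \<longleftrightarrow> x \<in> A" if "x \<in> M" for x
  proof
    assume "x \<in> A"
    then show "\<rho> x = 0"
      using \<rho>_le[of x x] \<rho>_nonneg[of x] that by simp
  next
    assume 0: "\<rho> x = 0"
    show "x \<in> A"
    proof (rule ccontr)
      assume "x \<notin> A"
      then have "openin mtopology (M - A)" "x \<in> M - A"
        using A that by (auto simp: X closedin_def)
      then obtain r where r: "r > 0" "mball x r \<subseteq> M - A"
        unfolding openin_mtopology by blast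
      then have "r \<le> d x a" if "a \<in> A" for a
        using that \<open>x \<in> M\<close> AM by (metis DiffD2 in_mball not_le subsetD)
      then have "r \<le> \<rho> x"
        unfolding \<rho>_def using False by (intro cINF_greatest) auto
      then show False
        using 0 r by simp
    qed
  qed
  have "continuous_map mtopology euclideanreal \<rho>"
  proof -
    have "\<bar>\<rho> x - \<rho> y\<bar> \<le> d x y" if "x \<in> M" "y \<in> M" for x y
      using Lip[OF that] Lip[OF that(2,1)] commute[of x y] by linarith
    then have close: "dist (\<rho> x) (\<rho> y) < \<epsilon>" if "y \<in> mball x \<epsilon>" for x y \<epsilon>
      using that by (force simp: dist_real_def)
    have "continuous_map mtopology Met_TC.mtopology \<rho>"
      unfolding Met_TC.continuous_map_to_metric
    proof (intro ballI allI impI)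
      fix x and \<epsilon> :: real
      assume "x \<in> topspace mtopology" "0 < \<epsilon>"
      then show "\<exists>U. openin mtopology U \<and> x \<in> U \<and> (\<forall>y\<in>U. \<rho> y \<in> Met_TC.mball (\<rho> x) \<epsilon>)"
        using close by (intro exI[of _ "mball x \<epsilon>"]) simp
    qed
    then show ?thesis by simp
  qed
  then have "continuous_map X (top_of_set {0..1}) (\<lambda>x. min 1 (\<rho> x))"
    unfolding X continuous_map_in_subtopology
    by (auto intro!: continuous_map_real_min simp: \<rho>_nonneg)
  moreover have "min 1 (\<rho> x) = 0 \<longleftrightarrow> x \<in> A" if "x \<in> topspace X" for x
    using zero_iff[of x] that by (auto simp: X min_def)
  ultimately show ?thesis
    by (rule that)
qed

section \<open>Realising closed sets as limit sets\<close>

lemma closedin_alpha_limit: "closedin X (alpha_limit X f x)"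
  unfolding alpha_limit_def by (rule closedin_Inter) auto

lemma is_alpha_limit_set_empty:
  fixes X :: "'a topology"
  assumes "x \<in> topspace X" "c \<in> topspace X" "x \<noteq> c"
  shows "is_alpha_limit_set X {}"
proof -
  have "((\<lambda>_. c) ^^ Suc k) y = c" for k and y :: 'a
    by simp
  then have "((\<lambda>_. c) ^^ k) y \<noteq> x" if "k \<in> {1..}" for k and y :: 'a
    using that \<open>x \<noteq> c\<close> by (cases k) (metis atLeast_iff not_one_le_zero, metis)
  then have "(\<Union>k\<in>{1..}. {y \<in> topspace X. ((\<lambda>_. c) ^^ k) y = x}) = {}"
    by blast
  then have "alpha_limit X (\<lambda>_. c) x \<subseteq> X closure_of {}"
    unfolding alpha_limit_def by (metis (lifting) INT_lower UNIV_I)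
  then have "alpha_limit X (\<lambda>_. c) x = {}"
    by simp
  then show ?thesis
    unfolding is_alpha_limit_set_def using assms
    by (intro exI[of _ "\<lambda>_. c"] exI[of _ x]) auto
qed

text \<open>
  Both \<open>A\<close> and its complement are forward invariant, so \<open>f\<^sup>k\<close> takes a value in \<open>A\<close> only at points
  of \<open>A\<close>; and at those points the value is \<open>a\<close> once \<open>k\<close> is positive.
\<close>

lemma is_alpha_limit_set_collapsible:
  assumes f: "continuous_map X X f" and A: "closedin X A" and a: "a \<in> A"
    and collapse: "\<And>y. y \<in> A \<Longrightarrow> f y = a"
    and outside: "\<And>y. y \<in> topspace X - A \<Longrightarrow> f y \<notin> A"
  shows "is_alpha_limit_set X A"
proof -
  have AX: "A \<subseteq> topspace X"
    by (rule closedin_subset[OF A])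
  have fX: "f y \<in> topspace X" if "y \<in> topspace X" for y
    using f that by (auto simp: continuous_map_def)
  have iter: "((f ^^ k) y \<in> A \<longleftrightarrow> y \<in> A) \<and> (f ^^ k) y \<in> topspace X" if "y \<in> topspace X" for k y
    using that by (induction k) (use a collapse outside fX in auto)
  have "(f ^^ Suc k) y = a \<longleftrightarrow> y \<in> A" if "y \<in> topspace X" for k y
    using iter[OF that, of k] iter[OF that, of "Suc k"] a collapse by auto
  then have pre: "{y \<in> topspace X. (f ^^ k) y = a} = A" if "0 < k" for k
    using that AX by (cases k) auto
  have "alpha_limit X f a = A"
  proof
    have "alpha_limit X f a \<subseteq> X closure_of (\<Union>k\<in>{1..}. {y \<in> topspace X. (f ^^ k) y = a})"
      unfolding alpha_limit_def by blast
    also have "(\<Union>k\<in>{1..}. {y \<in> topspace X. (f ^^ k) y = a}) = A"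
      using pre by (auto simp: Suc_le_eq)
    finally show "alpha_limit X f a \<subseteq> A"
      using A by (simp add: closure_of_closedin)
  next
    have "A \<subseteq> X closure_of (\<Union>k\<in>{n..}. {y \<in> topspace X. (f ^^ k) y = a})" for n
    proof -
      have "A \<subseteq> (\<Union>k\<in>{n..}. {y \<in> topspace X. (f ^^ k) y = a})"
        using pre[of "Suc n"] by (intro order_trans[OF _ UN_upper[of "Suc n"]]) auto
      then show ?thesis
        by (rule order_trans) (rule closure_of_subset, auto)
    qed
    then show "A \<subseteq> alpha_limit X f a"
      unfolding alpha_limit_def by blast
  qed
  then show ?thesis
    unfolding is_alpha_limit_set_def using f a AX by blast
qed

lemma is_alpha_limit_set_clopen:
  assumes cl: "closedin X A" and op: "openin X A" and "A \<noteq> {}"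
  shows "is_alpha_limit_set X A"
proof -
  obtain a where a: "a \<in> A"
    using \<open>A \<noteq> {}\<close> by blast
  have AX: "A \<subseteq> topspace X"
    by (rule closedin_subset[OF cl])
  \<comment> \<open>If \<open>A\<close> is the whole space, the value \<open>b\<close> is never taken.\<close>
  obtain b where b: "b \<in> topspace X" "A \<noteq> topspace X \<Longrightarrow> b \<notin> A"
    using AX a by blast
  have "continuous_map X X (\<lambda>y. if y \<in> A then a else b)"
  proof (rule continuous_map_cases)
    show "continuous_map (subtopology X (X closure_of {y. y \<in> A})) X (\<lambda>_. a)"
      using a AX by auto
    show "continuous_map (subtopology X (X closure_of {y. y \<notin> A})) X (\<lambda>_. b)"
      using b by auto
    show "a = b" if "y \<in> X frontier_of {y. y \<in> A}" for y
      using that cl op clopenin_eq_frontier_of[of X A] by auto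
  qed
  then show ?thesis
  proof (rule is_alpha_limit_set_collapsible[OF _ cl a])
    show "(if y \<in> A then a else b) \<notin> A" if "y \<in> topspace X - A" for y
      using that b(2) by (metis DiffD1 DiffD2)
  qed auto
qed

text \<open>
  The path visits \<open>A\<close> for a last time, say at time \<open>s < 1\<close>. The map sends a point at truncated distance
  \<open>t\<close> from \<open>A\<close> to the point of the path at time \<open>s + t (1 - s)\<close>, which is outside \<open>A\<close> unless
  \<open>t = 0\<close>.
\<close>

lemma is_alpha_limit_set_path_leaving:
  assumes X: "metrizable_space X" and A: "closedin X A"
    and h: "continuous_map (top_of_set {0..1::real}) X h" and h0: "h 0 \<in> A" and h1: "h 1 \<notin> A"
  shows "is_alpha_limit_set X A"
proof -
  define T where "T = {t \<in> {0..1}. h t \<in> A}"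
  have "closedin (top_of_set {0..1}) T"
    using closedin_continuous_map_preimage[OF h A] by (simp add: T_def)
  then have "compact T"
    by (metis closedin_compact compact_Icc)
  moreover have "0 \<in> T"
    using h0 by (simp add: T_def)
  ultimately obtain s where s: "s \<in> T" and last: "\<And>t. t \<in> T \<Longrightarrow> t \<le> s"
    using compact_attains_sup[of T] by blast
  have s01: "0 \<le> s" "s < 1" and hs: "h s \<in> A"
    using s h1 by (auto simp: T_def order.order_iff_strict)
  obtain \<phi> where \<phi>: "continuous_map X (top_of_set {0..1::real}) \<phi>"
    and \<phi>0: "\<And>x. x \<in> topspace X \<Longrightarrow> \<phi> x = 0 \<longleftrightarrow> x \<in> A"
    using metrizable_space_exact_zero_function[OF X A] by metis
  have \<phi>01: "0 \<le> \<phi> x" "\<phi> x \<le> 1" if "x \<in> topspace X" for x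
    using \<phi> that by (auto simp: continuous_map_in_subtopology Pi_iff)
  define u where "u x = s + \<phi> x * (1 - s)" for x
  have u01: "0 \<le> u x" "u x \<le> 1" if "x \<in> topspace X" for x
  proof -
    show "0 \<le> u x"
      using \<phi>01[OF that] s01 by (simp add: u_def)
    have "\<phi> x * (1 - s) \<le> 1 * (1 - s)"
      using \<phi>01[OF that] s01 by (intro mult_right_mono) auto
    then show "u x \<le> 1"
      using add_left_mono[of _ _ s] by (fastforce simp: u_def)
  qed
  have "continuous_map X (top_of_set {0..1}) u"
    unfolding continuous_map_in_subtopology
  proof
    have "continuous_map X euclideanreal \<phi>"
      using \<phi> by (simp add: continuous_map_in_subtopology)
    then show "continuous_map X euclideanreal u"
      unfolding u_def by (intro continuous_intros) auto
  qed (use u01 in auto)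
  then have cont: "continuous_map X X (h \<circ> u)"
    using h by (rule continuous_map_compose)
  show ?thesis
  proof (rule is_alpha_limit_set_collapsible[OF cont A hs])
    fix y assume "y \<in> A"
    then show "(h \<circ> u) y = h s"
      using \<phi>0[of y] closedin_subset[OF A] by (auto simp: u_def)
  next
    fix y assume y: "y \<in> topspace X - A"
    then have "0 < \<phi> y"
      using \<phi>0[of y] \<phi>01[of y] by fastforce
    then have "s < u y"
      using s01 by (simp add: u_def)
    then have "u y \<notin> T"
      using last by fastforce
    then show "(h \<circ> u) y \<notin> A"
      using u01[of y] y by (auto simp: T_def)
  qed
qed

section \<open>Sums of spaces with enough arcs\<close>

theorem proposition16:
  fixes X :: "'i \<Rightarrow> 'a topology" and \<Lambda> :: "'i set"
  assumes "\<Lambda> \<noteq> {}"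
    and "\<And>i. i \<in> \<Lambda> \<Longrightarrow> enough_arcs (X i)"
  shows "AF_property (sum_topology X \<Lambda>)"
proof -
  let ?S = "sum_topology X \<Lambda>"
  have metr: "metrizable_space ?S"
    using assms(2) by (intro metrizable_space_sum_topology) (simp add: enough_arcs_def)
  have "is_alpha_limit_set ?S A" if A: "closedin ?S A" for A
  proof (cases "A = {}")
    case True
    obtain i where i: "i \<in> \<Lambda>"
      using assms(1) by blast
    then obtain x y where "x \<in> topspace (X i)" "y \<in> topspace (X i)" "x \<noteq> y"
      using assms(2)[OF i] unfolding enough_arcs_def by blast
    then show ?thesis
      using i is_alpha_limit_set_empty[of "(i, x)" ?S "(i, y)"] True by simp
  next
    case nonempty: False
    let ?A = "\<lambda>i. {x. (i, x) \<in> A}"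
    have Ai: "closedin (X i) (?A i)" if "i \<in> \<Lambda>" for i
      using A that by (simp add: closedin_sum_topology)
    show ?thesis
    proof (cases "\<exists>i\<in>\<Lambda>. ?A i \<noteq> {} \<and> ?A i \<noteq> topspace (X i)")
      case True
      then obtain i where i: "i \<in> \<Lambda>" and proper: "?A i \<noteq> {}" "?A i \<noteq> topspace (X i)"
        by blast
      then obtain C a b where arc: "arc_with_endpoints (X i) C a b" "a \<in> ?A i" "b \<notin> ?A i"
        using assms(2)[OF i] Ai[OF i] unfolding enough_arcs_def by blast
      then obtain h where h: "homeomorphic_map (top_of_set {0..1::real}) (subtopology (X i) C) h"
        and ends: "h 0 = a" "h 1 = b"
        unfolding arc_with_endpoints_def by blast
      have "continuous_map (top_of_set {0..1}) (X i) h"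
        using homeomorphic_imp_continuous_map[OF h] by (rule continuous_map_into_fulltopology)
      then have "continuous_map (top_of_set {0..1}) ?S ((\<lambda>x. (i, x)) \<circ> h)"
        using continuous_map_component_injection[OF i] by (rule continuous_map_compose)
      then show ?thesis
        by (rule is_alpha_limit_set_path_leaving[OF metr A]) (use arc ends in auto)
    next
      case False
      then have "openin (X i) (?A i)" if "i \<in> \<Lambda>" for i
        using that by (metis openin_empty openin_topspace)
      then have "openin ?S A"
        using closedin_subset[OF A] by (simp add: openin_sum_topology)
      then show ?thesis
        by (rule is_alpha_limit_set_clopen[OF A _ nonempty])
    qed
  qed
  moreover have "closedin ?S A" if "is_alpha_limit_set ?S A" for A
    using that unfolding is_alpha_limit_set_def by (auto intro: closedin_alpha_limit)
  ultimately show ?thesis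
    unfolding AF_property_def using metr by blast
qed

end
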